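(* Let $d,n\ge1$ be integers, and let $V$ be the swap operator on $\mathbb C^d\otimes\mathbb C^d$. Let $A^0,\dots,A^{n-1}$ be Hermitian $d^2\times d^2$ matrices acting on $\mathbb C^d\otimes\mathbb C^d$ for which there exist complex $d\times d$ matrices $D^{ij}$, $i,j\in\{0,\dots,n-1\}$, with $D^{ij}=(D^{ji})^\dagger$ and $D^{ii}=0$, such that $$A^i+VA^jV+\big((\mathbb I\otimes D^{ij})V+\mathrm{h.c.}\big)\ \ge\ 0\qquad\text{for all } i,j\in\{0,\dots,n-1\}.$$ Define $W_i=\mathrm{Tr}_2A^i$. Then for every simulable POVM $(M_0,\dots,M_{n-1})\in\mathcal P(d,n)$, $$\sum_{i=0}^{n-1}\mathrm{Tr}(W_iM_i)\ \ge\ 0.$$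
   Context: A $d$-dimensional POVM with $n$ effects is a tuple $(M_0,\dots,M_{n-1})$ of positive semidefinite complex $d\times d$ matrices with $\sum_{i=0}^{n-1} M_i=\mathbb I_d$. It is projective if $M_iM_j=\delta_{ij}M_i$ for all $i,j$ (zero effects are allowed). The set $\mathcal P(d,n)$ of (projectively) simulable POVMs is the convex hull of the set of projective $d$-dimensional POVMs with $n$ effects, i.e. $(M_i)\in\mathcal P(d,n)$ iff $M_i=\sum_{k=1}^N p_kP_i^k$ for all $i$, for some $N$, some probability distribution $(p_k)$ and some projective POVMs $\{P_0^k,\dots,P_{n-1}^k\}$. The swap operator is $V=\sum_{i,j=0}^{d-1}|ij\rangle\langle ji|$. $\mathrm{Tr}_2$ is the partial trace over the second tensor factor of $\mathbb C^d\otimes\mathbb C^d$; "$X+\mathrm{h.c.}$" means $X+X^\dagger$; "$\ge0$" for a matrix means positive semidefinite. *)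

theory Defs
  imports "HOL-Analysis.Analysis"
begin

text \<open>
  A \<open>d \<times> d\<close> complex matrix is an element of \<^typ>\<open>complex^'d^'d\<close> with \<open>CARD('d) = d\<close>. The space
  \<open>\<complex>\<^sup>d \<otimes> \<complex>\<^sup>d\<close> has the product basis indexed by \<^typ>\<open>'d \<times> 'd\<close>, so the basis vector
  \<open>|ij\<rangle>\<close> has index \<open>(i, j)\<close>. A tuple of \<open>n\<close> matrices is an element of
  \<^typ>\<open>complex^'d^'d^'n\<close> with \<open>CARD('n) = n\<close>, which is a real vector space.
  The order on \<^typ>\<open>complex\<close> is such that \<open>0 \<le> z\<close> means that \<open>z\<close> is real and nonnegative.
\<close>

definition cadjoint :: "complex^'n^'m \<Rightarrow> complex^'m^'n" where
  "cadjoint A = (\<chi> i j. cnj (A $ j $ i))"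

definition hermitian :: "complex^'n^'n \<Rightarrow> bool" where
  "hermitian A \<longleftrightarrow> cadjoint A = A"

definition psd :: "complex^'n^'n \<Rightarrow> bool" where
  "psd A \<longleftrightarrow> hermitian A \<and> (\<forall>v. 0 \<le> (\<Sum>i\<in>UNIV. cnj (v $ i) * (A *v v) $ i))"

definition kron :: "complex^'a^'a \<Rightarrow> complex^'b^'b \<Rightarrow> complex^('a::finite \<times> 'b::finite)^('a \<times> 'b)" where
  "kron A B = (\<chi> p q. A $ fst p $ fst q * B $ snd p $ snd q)"

definition ptrace2 :: "complex^('a::finite \<times> 'b::finite)^('a \<times> 'b) \<Rightarrow> complex^'a^'a" where
  "ptrace2 X = (\<chi> i j. \<Sum>k\<in>UNIV. X $ (i, k) $ (j, k))"

text \<open>\<open>ketbra p q\<close> is the matrix unit \<open>|p\<rangle>\<langle>q|\<close>.\<close>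

definition ketbra :: "'n \<Rightarrow> 'n \<Rightarrow> complex^'n^'n" where
  "ketbra p q = (\<chi> r s. if r = p \<and> s = q then 1 else 0)"

definition swap_op :: "complex^('d::finite \<times> 'd)^('d \<times> 'd)" where
  "swap_op = (\<Sum>i\<in>UNIV. \<Sum>j\<in>UNIV. ketbra (i, j) (j, i))"

definition povm :: "complex^'d^'d^'n \<Rightarrow> bool" where
  "povm M \<longleftrightarrow> (\<forall>i. psd (M $ i)) \<and> (\<Sum>i\<in>UNIV. M $ i) = mat 1"

definition projective_povm :: "complex^'d^'d^'n \<Rightarrow> bool" where
  "projective_povm M \<longleftrightarrow>
     povm M \<and> (\<forall>i j. M $ i ** M $ j = (if i = j then M $ i else 0))"

definition simulable_povms :: "(complex^'d^'d^'n) set" where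
  "simulable_povms = convex hull {P. projective_povm P}"

lemma swap_op_nth: "swap_op $ p $ q = (if q = prod.swap p then 1 else 0)"
proof -
  have eq: "swap_op $ p $ q =
      (\<Sum>i\<in>UNIV. \<Sum>j\<in>UNIV. if p = (i, j) \<and> q = (j, i) then 1 else 0)"
    by (simp add: swap_op_def ketbra_def)
  also have "\<dots> = (\<Sum>x\<in>UNIV. if p = x \<and> q = prod.swap x then 1 else 0)"
    by (simp add: sum.cartesian_product split_def prod.swap_def)
  also have "\<dots> = (\<Sum>x\<in>UNIV. if x = p then (if q = prod.swap p then 1 else 0) else 0)"
    by (rule sum.cong) auto
  finally show ?thesis by simp
qed

lemma simulable_povms_iff:
  fixes M :: "complex^'d^'d^'n"
  shows "M \<in> simulable_povms \<longleftrightarrow>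
    (\<exists>(N::nat) p P. (\<forall>k\<in>{1..N}. 0 \<le> p k \<and> projective_povm (P k)) \<and> (\<Sum>k=1..N. p k) = 1 \<and>
       (\<forall>i. M $ i = (\<Sum>k=1..N. p k *\<^sub>R (P k $ i))))"
proof -
  have *: "(\<Sum>k=1..N. p k *\<^sub>R P k) = M \<longleftrightarrow> (\<forall>i. M $ i = (\<Sum>k=1..N. p k *\<^sub>R (P k $ i)))"
    for N :: nat and p and P :: "nat \<Rightarrow> complex^'d^'d^'n"
    by (subst vec_eq_iff) (simp only: sum_component vector_scaleR_component eq_commute)
  show ?thesis
    unfolding simulable_povms_def convex_hull_indexed mem_Collect_eq * ..
qed

end

theory Submission
  imports Defs
begin

text \<open>
  By convexity it suffices to treat a projective POVM \<open>P\<close>. Since \<open>\<Sum>j. P j = 1\<close>, the sum is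
  \<open>\<Sum>i j. Tr (A i (P i \<otimes> P j))\<close>, and relabelling \<open>i, j\<close> together with \<open>V (P i \<otimes> P j) V = P j \<otimes> P i\<close>
  turns twice this into \<open>\<Sum>i j. Tr ((A i + V A j V) (P i \<otimes> P j))\<close>. The \<open>D\<close>-terms can be added for
  free, because \<open>Tr ((1 \<otimes> D i j) V (P i \<otimes> P j)) = Tr (D i j P i P j)\<close> vanishes: \<open>P i P j = 0\<close> for
  \<open>i \<noteq> j\<close>, and \<open>D i i = 0\<close>. Each resulting summand is the trace of a positive
  semidefinite matrix against a projection.
\<close>

lemma cadjoint_mult: "cadjoint (A ** B) = cadjoint B ** cadjoint A"
  by (simp add: vec_eq_iff cadjoint_def matrix_matrix_mult_def mult.commute)

lemma trace_cadjoint: "trace (cadjoint A) = cnj (trace A)"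
  by (simp add: trace_def cadjoint_def)

lemma trace_sum: "trace (\<Sum>i\<in>S. f i :: 'a::semiring_1^'n^'n) = (\<Sum>i\<in>S. trace (f i))"
  unfolding trace_def by (simp only: sum_component) (rule sum.swap)

lemma trace_scaleR: "trace (c *\<^sub>R A :: 'a::real_algebra_1^'n^'n) = c *\<^sub>R trace A"
  by (simp add: trace_def scaleR_right.sum)

lemma matrix_mult_add_left: "(A + B) ** C = A ** C + B ** (C :: 'a::semiring_1^'n^'m)"
  by (simp add: vec_eq_iff matrix_matrix_mult_def distrib_right sum.distrib)

lemma matrix_mult_sum_right: "A ** (\<Sum>i\<in>S. f i) = (\<Sum>i\<in>S. A ** (f i :: 'a::semiring_1^'n^'m))"
  by (induction S rule: infinite_finite_induct) (simp_all add: matrix_add_ldistrib)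

lemma sum_prod_UNIV:
  "(\<Sum>p\<in>(UNIV :: ('a::finite \<times> 'b::finite) set). f p) = (\<Sum>a\<in>UNIV. \<Sum>b\<in>UNIV. f (a, b))"
  by (simp add: sum.cartesian_product)

lemma kron_mult: "kron A B ** kron C D = kron (A ** C) (B ** D)"
  by (simp add: vec_eq_iff kron_def matrix_matrix_mult_def sum_prod_UNIV sum_product mult_ac)

lemma cadjoint_kron: "cadjoint (kron A B) = kron (cadjoint A) (cadjoint B)"
  by (simp add: vec_eq_iff kron_def cadjoint_def)

lemma kron_sum_right: "kron A (\<Sum>i\<in>S. f i) = (\<Sum>i\<in>S. kron A (f i))"
  by (simp add: vec_eq_iff kron_def sum_distrib_left)

lemma matrix_mult_swap_op: "(X ** swap_op) $ p $ q = X $ p $ prod.swap q"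
proof -
  have "(X ** swap_op) $ p $ q = (\<Sum>r\<in>UNIV. if r = prod.swap q then X $ p $ r else 0)"
    unfolding matrix_matrix_mult_def vec_lambda_beta by (rule sum.cong) (auto simp: swap_op_nth)
  then show ?thesis by simp
qed

lemma swap_op_matrix_mult: "(swap_op ** X) $ p $ q = X $ prod.swap p $ q"
proof -
  have "(swap_op ** X) $ p $ q = (\<Sum>r\<in>UNIV. if r = prod.swap p then X $ r $ q else 0)"
    unfolding matrix_matrix_mult_def vec_lambda_beta by (rule sum.cong) (auto simp: swap_op_nth)
  then show ?thesis by simp
qed

lemma swap_op_kron: "swap_op ** kron A B = kron B A ** swap_op"
  by (simp add: vec_eq_iff swap_op_matrix_mult matrix_mult_swap_op kron_def)

lemma swap_op_swap_op: "swap_op ** swap_op = mat 1"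
  by (auto simp: vec_eq_iff swap_op_matrix_mult swap_op_nth mat_def)

text \<open>The swap trick: right multiplication by V exchanges the two column indices, so the
  diagonal entry at (a, b) becomes A_ab B_ba.\<close>

lemma trace_kron_swap_op: "trace (kron A B ** swap_op) = trace (A ** B)"
  unfolding trace_def matrix_mult_swap_op sum_prod_UNIV
  by (simp add: kron_def matrix_matrix_mult_def)

text \<open>Under the trace pairing, the partial trace is dual to tensoring with the identity: the
  factor \<open>mat 1\<close> forces the second indices to agree, which is exactly the contraction
  in \<open>ptrace2\<close>.\<close>

lemma trace_ptrace2_mult: "trace (ptrace2 X ** B) = trace (X ** kron B (mat 1))"
proof -
  have "trace (X ** kron B (mat 1)) =
      (\<Sum>i\<in>UNIV. \<Sum>k\<in>UNIV. \<Sum>j\<in>UNIV. X $ (i, k) $ (j, k) * B $ j $ i)"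
    by (simp add: trace_def matrix_matrix_mult_def kron_def mat_def sum_prod_UNIV
        if_distrib[where f = "\<lambda>x. _ * x"] cong: if_cong)
  also have "\<dots> = (\<Sum>i\<in>UNIV. \<Sum>j\<in>UNIV. \<Sum>k\<in>UNIV. X $ (i, k) $ (j, k) * B $ j $ i)"
    by (intro sum.cong refl sum.swap)
  finally show ?thesis
    by (simp add: trace_def matrix_matrix_mult_def ptrace2_def sum_distrib_right)
qed

lemma trace_swap_conj_mult_kron:
  "trace (swap_op ** X ** swap_op ** kron P Q) = trace (X ** kron Q P)"
proof -
  have "trace (swap_op ** X ** swap_op ** kron P Q) = trace (swap_op ** (X ** kron Q P ** swap_op))"
    by (simp add: matrix_mul_assoc[symmetric] swap_op_kron)
  also have "\<dots> = trace (X ** kron Q P ** (swap_op ** swap_op))"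
    by (subst trace_mul_sym) (simp add: matrix_mul_assoc)
  finally show ?thesis by (simp add: swap_op_swap_op)
qed

text \<open>Pushing V to the right exchanges P and Q, after which the swap trick gives Tr (Q D P);
  cyclicity then brings P and Q together.\<close>

lemma trace_kron_swap_mult_kron:
  "trace (kron (mat 1) D ** swap_op ** kron P Q) = trace (D ** (P ** Q))"
proof -
  have "kron (mat 1) D ** swap_op ** kron P Q = kron (mat 1) D ** kron Q P ** swap_op"
    by (simp add: matrix_mul_assoc[symmetric] swap_op_kron)
  also have "\<dots> = kron Q (D ** P) ** swap_op"
    by (simp add: kron_mult)
  finally have "trace (kron (mat 1) D ** swap_op ** kron P Q) = trace (Q ** (D ** P))"
    by (simp add: trace_kron_swap_op)
  also have "\<dots> = trace (D ** P ** Q)"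
    by (rule trace_mul_sym)
  finally show ?thesis
    by (simp add: matrix_mul_assoc)
qed

text \<open>A projection satisfies Q = Q Q and Q is self-adjoint, so cyclicity turns the trace into
  that of \<open>cadjoint Q ** X ** Q\<close>, a sum of values of the quadratic form of X at the
  columns of Q.\<close>

lemma trace_psd_mult_projection_nonneg:
  assumes "psd X" and "hermitian Q" and "Q ** Q = Q"
  shows "0 \<le> trace (X ** Q)"
proof -
  have "trace (X ** Q) = trace (X ** Q ** Q)"
    using assms(3) by (simp add: matrix_mul_assoc[symmetric])
  also have "\<dots> = trace (cadjoint Q ** (X ** Q))"
    using assms(2) by (simp add: trace_mul_sym[of _ Q] hermitian_def)
  also have "\<dots> = (\<Sum>k\<in>UNIV. \<Sum>i\<in>UNIV. cnj (column k Q $ i) * (X *v column k Q) $ i)"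
    by (simp add: trace_def matrix_matrix_mult_def cadjoint_def column_def matrix_vector_mult_def)
  also have "0 \<le> \<dots>"
    by (rule sum_nonneg) (use assms(1) in \<open>simp add: psd_def\<close>)
  finally show ?thesis .
qed

lemma witness_projective_nonneg:
  fixes A :: "'n::finite \<Rightarrow> complex^('d::finite \<times> 'd)^('d \<times> 'd)" and P :: "complex^'d^'d^'n"
  assumes D_diag: "\<And>i. D i i = 0"
    and A_psd: "\<And>i j. psd (A i + swap_op ** A j ** swap_op
                  + (kron (mat 1) (D i j) ** swap_op
                     + cadjoint (kron (mat 1) (D i j) ** swap_op)))"
    and P: "projective_povm P"
  shows "0 \<le> (\<Sum>i\<in>UNIV. trace (ptrace2 (A i) ** P $ i))"
proof -
  have P_adj: "cadjoint (P $ i) = P $ i" for i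
    using P by (simp add: projective_povm_def povm_def psd_def hermitian_def)
  have P_sum: "(\<Sum>j\<in>UNIV. P $ j) = mat 1"
    using P by (simp add: projective_povm_def povm_def)
  have P_mult: "P $ i ** P $ j = (if i = j then P $ i else 0)" for i j
    using P by (simp add: projective_povm_def)
  let ?K = "\<lambda>i j. kron (P $ i) (P $ j)"
  let ?t = "\<lambda>i j. trace (A i ** ?K i j)"
  let ?S = "\<Sum>i\<in>UNIV. trace (ptrace2 (A i) ** P $ i)"
  have K_adj: "cadjoint (?K i j) = ?K i j" for i j
    by (simp add: cadjoint_kron P_adj)
  have D_term: "trace (kron (mat 1) (D i j) ** swap_op ** ?K i j) = 0" for i j
    unfolding trace_kron_swap_mult_kron P_mult
    by (cases "i = j") (simp_all add: D_diag trace_def)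
  have D_adj_term: "trace (cadjoint (kron (mat 1) (D i j) ** swap_op) ** ?K i j) = 0" for i j
  proof -
    let ?X = "kron (mat 1) (D i j) ** swap_op"
    \<comment> \<open>As \<open>?K i j\<close> is self-adjoint, the trace of the conjugate term is
      the complex conjugate of the one already shown to vanish.\<close>
    have "trace (cadjoint ?X ** ?K i j) = trace (cadjoint (?K i j ** ?X))"
      by (simp only: cadjoint_mult K_adj)
    then show ?thesis
      by (simp add: trace_cadjoint trace_mul_sym[of "?K i j"] D_term)
  qed
  \<comment> \<open>\<open>?K i j\<close> is itself a projection, being a tensor product of
    projections; the conjugated \<open>A j\<close> contributes \<open>?t j i\<close>.\<close>
  have summand: "0 \<le> ?t i j + ?t j i" for i j
  proof -
    have "0 \<le> trace ((A i + swap_op ** A j ** swap_op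
        + (kron (mat 1) (D i j) ** swap_op + cadjoint (kron (mat 1) (D i j) ** swap_op))) ** ?K i j)"
      by (intro trace_psd_mult_projection_nonneg A_psd)
        (simp_all add: hermitian_def K_adj kron_mult P_mult)
    then show ?thesis
      by (simp add: matrix_mult_add_left trace_add D_term D_adj_term trace_swap_conj_mult_kron)
  qed
  \<comment> \<open>The identity in the second tensor factor is resolved as the sum of all
    \<open>P $ j\<close>.\<close>
  have S_eq: "?S = (\<Sum>i\<in>UNIV. \<Sum>j\<in>UNIV. ?t i j)"
    by (simp add: trace_ptrace2_mult P_sum[symmetric] kron_sum_right matrix_mult_sum_right trace_sum)
  also have "\<dots> = (\<Sum>i\<in>UNIV. \<Sum>j\<in>UNIV. ?t j i)"
    by (rule sum.swap)
  finally have "?S + ?S = (\<Sum>i\<in>UNIV. \<Sum>j\<in>UNIV. ?t i j + ?t j i)"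
    using S_eq by (simp add: sum.distrib)
  also have "0 \<le> \<dots>"
    by (intro sum_nonneg summand)
  \<comment> \<open>The order on complex numbers is componentwise, so doubling can be undone in the
    real and imaginary parts separately.\<close>
  finally show ?thesis
    by (simp add: less_eq_complex_def)
qed

theorem theorem5:
  fixes A :: "'n::finite \<Rightarrow> complex^('d::finite \<times> 'd)^('d \<times> 'd)"
    and W :: "'n \<Rightarrow> complex^'d^'d"
    and M :: "complex^'d^'d^'n"
  assumes A_hermitian: "\<And>i. hermitian (A i)"
    and A_psd: "\<exists>D :: 'n \<Rightarrow> 'n \<Rightarrow> complex^'d^'d.
      (\<forall>i j. D i j = cadjoint (D j i)) \<and> (\<forall>i. D i i = 0) \<and>
      (\<forall>i j. psd (A i + swap_op ** A j ** swap_op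
                  + (kron (mat 1) (D i j) ** swap_op
                     + cadjoint (kron (mat 1) (D i j) ** swap_op))))"
    and W_def: "\<And>i. W i = ptrace2 (A i)"
    and M_simulable: "M \<in> simulable_povms"
  shows "0 \<le> (\<Sum>i\<in>UNIV. trace (W i ** M $ i))"
proof -
  obtain D where D: "\<And>i. D i i = 0"
    "\<And>i j. psd (A i + swap_op ** A j ** swap_op
                  + (kron (mat 1) (D i j) ** swap_op
                     + cadjoint (kron (mat 1) (D i j) ** swap_op)))"
    using A_psd by blast
  let ?f = "\<lambda>M :: complex^'d^'d^'n. \<Sum>i\<in>UNIV. trace (W i ** M $ i)"
  have f_linear: "?f (u *\<^sub>R X + v *\<^sub>R Y) = u *\<^sub>R ?f X + v *\<^sub>R ?f Y" for u v X Y
    by (simp add: matrix_add_ldistrib trace_add matrix_scalar_ac scalar_matrix_assoc[symmetric]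
        trace_scaleR sum.distrib scaleR_right.sum)
  \<comment> \<open>This set is the preimage of a convex cone, the nonnegative reals, under a
    real-linear map; containing the projective POVMs, it contains their hull.\<close>
  have "convex {M. 0 \<le> ?f M}"
    by (rule convexI) (simp only: mem_Collect_eq f_linear, simp add: less_eq_complex_def)
  moreover have "{P. projective_povm P} \<subseteq> {M. 0 \<le> ?f M}"
    using witness_projective_nonneg[OF D] by (auto simp: W_def)
  ultimately have "simulable_povms \<subseteq> {M. 0 \<le> ?f M}"
    unfolding simulable_povms_def by (intro hull_minimal)
  then show ?thesis
    using M_simulable by blast
qed

end
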